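(* Let $n\ge 1$ and $2\le q\le 4$. For every $h\in X_0$, $$F(h)=\int_{\mathbb R^n\times\mathbb R^n}\|x-y\|^q\,h(x)h(y)\,dx\,dy\ \ge\ 0.$$
   Context: $\|x\|$ is the Euclidean norm on $\mathbb R^n$. All functions are real-valued. Define $$X=\Big\{h\in L^1(\mathbb R^n):\ \int_{\mathbb R^n}(\|x\|^q+1)\,|h(x)|\,dx<\infty\Big\},$$ $$X_0=\Big\{h\in X:\ \int_{\mathbb R^n}h(x)\,dx=0,\ \int_{\mathbb R^n}x_i\,h(x)\,dx=0\ \text{ for } 1\le i\le n\Big\}.$$ *)

theory Defs
  imports "HOL-Analysis.Analysis"
begin

text \<open>
  Elements of \<open>L\<^sup>1\<close> are represented by Lebesgue integrable functions rather than by
  classes modulo null sets; everything below depends only on the class.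
  The exponent \<open>q\<close> of the weight is an explicit parameter of the spaces.
\<close>

definition X_space :: "real \<Rightarrow> (real ^ 'n \<Rightarrow> real) set" where
  "X_space q = {h. integrable lebesgue h \<and>
                   integrable lebesgue (\<lambda>x. (norm x powr q + 1) * \<bar>h x\<bar>)}"

text \<open>
  For \<open>q \<ge> 1\<close> and \<open>h\<close> in \<open>X_space q\<close> the first moments below converge absolutely,
  since \<open>\<bar>x $ i\<bar> \<le> norm x powr q + 1\<close>.
\<close>

definition X0_space :: "real \<Rightarrow> (real ^ 'n \<Rightarrow> real) set" where
  "X0_space q = {h \<in> X_space q.
                   (LINT x|lebesgue. h x) = 0 \<and>
                   (\<forall>i. (LINT x|lebesgue. x $ i * h x) = 0)}"

text \<open>
  The double integral is taken with respect to Lebesgue measure on the product space. For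
  \<open>q \<ge> 1\<close> and \<open>h\<close> in \<open>X_space q\<close> the integrand is absolutely integrable, because
  \<open>norm (x - y) powr q \<le> 2 powr (q - 1) * (norm x powr q + norm y powr q)\<close>, so the value
  is never the default value of a divergent integral.
\<close>

definition F :: "real \<Rightarrow> (real ^ 'n \<Rightarrow> real) \<Rightarrow> real" where
  "F q h = (LINT (x, y)|(lebesgue :: ((real ^ 'n) \<times> (real ^ 'n)) measure).
              norm (x - y) powr q * h x * h y)"

end

theory Submission
  imports Defs "HOL-Probability.Distributions"
begin

text \<open>
  For \<open>2 < q < 4\<close> and \<open>r \<ge> 0\<close>, substituting \<open>s = t r\<^sup>2\<close> shows that \<open>r powr q\<close> is a positive multiple of
  the integral over \<open>t > 0\<close> of \<open>(exp (- t r\<^sup>2) - 1 + t r\<^sup>2) t powr (- q / 2 - 1)\<close>, whose integrand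
  is nonnegative. Put \<open>r = norm (x - y)\<close>, integrate against \<open>h x * h y\<close> and exchange the
  integrals: the constant kernel contributes \<open>0\<close> because \<open>h\<close> has mean zero, the kernel \<open>r\<^sup>2\<close>
  contributes \<open>0\<close> because the first moments vanish as well, and the Gaussian kernel is positive
  semidefinite. For \<open>q = 2\<close> the form is zero, and \<open>q = 4\<close> is the limit of smaller exponents.
\<close>

section \<open>Fubini tools for product and Lebesgue measures\<close>

text \<open>Both steps of the argument that superpose positive kernels rest on this: once over
  Gaussian centres \<open>w\<close>, once over the scale \<open>t\<close>. Since \<open>f\<close> is
  nonnegative, integrating \<open>\<bar>f p t * u p\<bar>\<close> over \<open>t\<close> gives
  exactly \<open>\<bar>k p * u p\<bar>\<close>, so \<open>ku\<close> alone yields joint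
  integrability and Fubini applies to the signed integrand.\<close>

lemma integral_mixture_nonneg:
  fixes f :: "'a \<Rightarrow> 'b \<Rightarrow> real" and u k :: "'a \<Rightarrow> real"
  assumes "sigma_finite_measure P" and "sigma_finite_measure N"
    and f [measurable]: "(\<lambda>z. f (fst z) (snd z)) \<in> borel_measurable (P \<Otimes>\<^sub>M N)"
    and u [measurable]: "u \<in> borel_measurable P"
    and f_nonneg: "\<And>p t. 0 \<le> f p t"
    and k: "\<And>p. has_bochner_integral N (f p) (k p)"
    and ku: "integrable P (\<lambda>p. k p * u p)"
    and slices: "\<And>t. 0 \<le> (LINT p|P. f p t * u p)"
  shows "0 \<le> (LINT p|P. k p * u p)"
proof -
  interpret P: sigma_finite_measure P by fact
  interpret N: sigma_finite_measure N by fact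
  interpret pair_sigma_finite P N ..
  have int_f: "integrable N (f p)" and int_eq: "(LINT t|N. f p t) = k p" for p
    using k[of p] by (auto simp: has_bochner_integral_iff)
  have k_nonneg: "0 \<le> k p" for p
    unfolding int_eq[symmetric] using f_nonneg by simp
  have joint: "integrable (P \<Otimes>\<^sub>M N) (case_prod (\<lambda>p t. f p t * u p))"
  proof (rule Fubini_integrable)
    show "case_prod (\<lambda>p t. f p t * u p) \<in> borel_measurable (P \<Otimes>\<^sub>M N)"
      by (simp add: case_prod_beta)
    have "(LINT t|N. norm (case_prod (\<lambda>p t. f p t * u p) (p, t))) = \<bar>k p * u p\<bar>" for p
      by (simp add: abs_mult f_nonneg k_nonneg int_eq)
    then show "integrable P (\<lambda>p. LINT t|N. norm (case_prod (\<lambda>p t. f p t * u p) (p, t)))"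
      using ku by simp
    show "AE p in P. integrable N (\<lambda>t. case_prod (\<lambda>p t. f p t * u p) (p, t))"
      using int_f by simp
  qed
  have "(LINT p|P. k p * u p) = (LINT p|P. LINT t|N. f p t * u p)"
    by (simp add: int_eq)
  also have "\<dots> = (LINT t|N. LINT p|P. f p t * u p)"
    using Fubini_integral[OF joint] by simp
  also have "\<dots> \<ge> 0"
    using slices by (intro integral_nonneg_AE) auto
  finally show ?thesis .
qed

lemma
  fixes f g :: "_ \<Rightarrow> real"
  assumes f: "integrable lborel f" and g: "integrable lborel g"
  shows integrable_lborel_tensor:
      "integrable (lborel \<Otimes>\<^sub>M lborel) (\<lambda>z. f (fst z) * g (snd z))" (is ?A)
    and integral_lborel_tensor:
      "(LINT z|(lborel \<Otimes>\<^sub>M lborel). f (fst z) * g (snd z)) = (LINT x|lborel. f x) * (LINT y|lborel. g y)"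
      (is ?B)
proof -
  have [measurable]: "f \<in> borel_measurable borel" "g \<in> borel_measurable borel"
    using f g by (auto dest: borel_measurable_integrable)
  show int: ?A
  proof (rule lborel_pair.Fubini_integrable)
    show "integrable lborel (\<lambda>x. LINT y|lborel. norm (f (fst (x, y)) * g (snd (x, y))))"
      using f by (simp add: abs_mult)
    show "AE x in lborel. integrable lborel (\<lambda>y. f (fst (x, y)) * g (snd (x, y)))"
      using g by simp
  qed measurable
  show ?B
    unfolding lborel_pair.integral_fst'[OF int, symmetric] by simp
qed

lemma lborel_has_bochner_integral_translate:
  fixes f :: "'a::euclidean_space \<Rightarrow> real"
  assumes "integrable lborel f"
  shows "has_bochner_integral lborel (\<lambda>x. f (x - c)) (LINT x|lborel. f x)"
proof -
  have [measurable]: "f \<in> borel_measurable borel"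
    using assms by (auto dest: borel_measurable_integrable)
  have d: "distr lborel borel (\<lambda>x. x - c) = lborel"
    using lborel_distr_plus[of "-c"] by (simp add: add.commute[of "-c"] cong: distr_cong)
  have "integrable lborel (\<lambda>x. f (x - c))"
    using assms integrable_distr_eq[of "\<lambda>x. x - c" lborel borel f] by (simp add: d)
  moreover have "(LINT x|lborel. f (x - c)) = (LINT x|lborel. f x)"
    using integral_distr[of "\<lambda>x. x - c" lborel borel f] by (simp add: d)
  ultimately show ?thesis
    by (simp add: has_bochner_integral_iff)
qed

section \<open>Gaussian integrals and the Gaussian kernel\<close>

lemma exp_norm_power2_eq_prod:
  fixes w :: "'a::euclidean_space"
  shows "exp (- c * (norm w)\<^sup>2) = (\<Prod>b\<in>Basis. exp (- c * (w \<bullet> b)\<^sup>2))"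
proof -
  have "(norm w)\<^sup>2 = (\<Sum>b\<in>Basis. (w \<bullet> b)\<^sup>2)"
    by (simp add: norm_eq_sqrt_inner euclidean_inner[of w w] power2_eq_square sum_nonneg)
  then show ?thesis
    by (simp add: sum_distrib_left exp_sum[symmetric] sum_negf)
qed

text \<open>The function factors over the coordinates, so its integral is a finite product of
  one-dimensional integrals, each a multiple of the integral of a normal density.\<close>

lemma integrable_gaussian:
  assumes c: "0 < (c::real)"
  shows "integrable lborel (\<lambda>w::'a::euclidean_space. exp (- c * (norm w)\<^sup>2))"
proof (rule integrableI_bounded)
  \<comment> \<open>The standard deviation that makes the exponent of the normal density
    \<open>- c * x^2\<close>; its normalising factor is then
    \<open>1 / sqrt (pi / c)\<close>.\<close>
  let ?s = "1 / sqrt (2 * c)"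
  have s: "?s\<^sup>2 = 1 / (2 * c)" "0 < ?s"
    using c by (auto simp: power_divide)
  have "exp (- c * x\<^sup>2) = sqrt (pi / c) * normal_density 0 ?s x" for x :: real
    unfolding normal_density_def s(1) using c by (simp add: real_sqrt_divide)
  moreover have "integrable lborel (\<lambda>x. sqrt (pi / c) * normal_density 0 ?s x)"
    using s(2) by simp
  ultimately have "integrable lborel (\<lambda>x::real. exp (- c * x\<^sup>2))"
    by simp
  then have fin: "(\<integral>\<^sup>+x. ennreal (exp (- c * x\<^sup>2)) \<partial>(lborel :: real measure)) < \<infinity>"
    by (subst nn_integral_eq_integral) auto
  have "(\<integral>\<^sup>+w. ennreal (norm (exp (- c * (norm w)\<^sup>2))) \<partial>(lborel :: 'a measure))
      = (\<integral>\<^sup>+w. (\<Prod>b\<in>Basis. ennreal (exp (- c * (w \<bullet> b)\<^sup>2))) \<partial>(lborel :: 'a measure))"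
    by (simp only: exp_norm_power2_eq_prod prod_ennreal real_norm_def abs_of_nonneg[OF prod_nonneg] exp_ge_zero)
  also have "\<dots> = (\<Prod>b\<in>(Basis::'a set). (\<integral>\<^sup>+x. ennreal (exp (- c * x\<^sup>2)) \<partial>lborel))"
    by (rule nn_integral_lborel_prod) auto
  also have "\<dots> < \<infinity>"
    using fin by (simp add: power_less_top_ennreal)
  finally show "(\<integral>\<^sup>+w. ennreal (norm (exp (- c * (norm w)\<^sup>2))) \<partial>(lborel :: 'a measure)) < \<infinity>" .
qed measurable

text \<open>Only the sign of this constant matters, because it is divided out later. A nonnegative
  function with integral zero vanishes almost everywhere, whereas the exponential vanishes
  nowhere.\<close>

lemma integral_gaussian_pos:
  assumes c: "0 < (c::real)"
  shows "0 < (LINT w|lborel. exp (- c * (norm (w::'a::euclidean_space))\<^sup>2))"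
proof -
  have "(LINT w|lborel. exp (- c * (norm (w::'a))\<^sup>2)) \<noteq> 0"
    using integrable_gaussian[OF c, where 'a = 'a]
    by (subst integral_nonneg_eq_0_iff_AE) (auto simp: eventually_False ae_filter_eq_bot_iff)
  moreover have "0 \<le> (LINT w|lborel. exp (- c * (norm (w::'a))\<^sup>2))"
    by simp
  ultimately show ?thesis by linarith
qed

text \<open>The Gaussian kernel is a mixture of the rank-one kernels
  \<open>exp (-2 t |x - w|\<^sup>2) exp (-2 t |y - w|\<^sup>2)\<close>, by the parallelogram law.\<close>

lemma gaussian_kernel_nonneg:
  fixes h :: "'a::euclidean_space \<Rightarrow> real"
  assumes h: "integrable lborel h" and t: "0 < t"
  shows "0 \<le> (LINT z|(lborel \<Otimes>\<^sub>M lborel). exp (- t * (norm (fst z - snd z))\<^sup>2) * (h (fst z) * h (snd z)))"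
proof -
  have [measurable]: "h \<in> borel_measurable borel"
    using h by (auto dest: borel_measurable_integrable)
  define C where "C = (LINT w|lborel. exp (- (4 * t) * (norm (w::'a))\<^sup>2))"
  have C: "0 < C"
    unfolding C_def using t by (intro integral_gaussian_pos) simp
  define f where "f = (\<lambda>z w::'a. exp (- (2 * t) * (norm (fst z - w))\<^sup>2) * exp (- (2 * t) * (norm (snd z - w))\<^sup>2))"
  \<comment> \<open>With \<open>z = (x, y)\<close>: \<open>2 |x - w|^2 + 2 |y - w|^2 = |x - y|^2 + 4
    |w - (x + y) / 2|^2\<close>. Hence \<open>w\<close> enters only through a translated Gaussian,
    whose integral \<open>C\<close> does not depend on \<open>z\<close>.\<close>
  have f_eq: "f z w = exp (- t * (norm (fst z - snd z))\<^sup>2) *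
      exp (- (4 * t) * (norm (w - (1/2) *\<^sub>R (fst z + snd z)))\<^sup>2)" for z w
    unfolding f_def exp_add[symmetric]
    by (simp add: power2_norm_eq_inner inner_simps inner_commute algebra_simps)
  have int: "integrable (lborel \<Otimes>\<^sub>M lborel) (\<lambda>z. exp (- t * (norm (fst z - snd z))\<^sup>2) * (h (fst z) * h (snd z)))"
  proof (rule Bochner_Integration.integrable_bound[OF integrable_lborel_tensor[OF h h]])
    show "AE z in lborel \<Otimes>\<^sub>M lborel. norm (exp (- t * (norm (fst z - snd z))\<^sup>2) * (h (fst z) * h (snd z)))
            \<le> norm (h (fst z) * h (snd z))"
      using t by (auto simp: abs_mult intro!: AE_I2 mult_left_le_one_le)
  qed measurable
  have "0 \<le> (LINT z|(lborel \<Otimes>\<^sub>M lborel). (exp (- t * (norm (fst z - snd z))\<^sup>2) * C) * (h (fst z) * h (snd z)))"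
  proof (rule integral_mixture_nonneg[where f = f and N = lborel])
    show "sigma_finite_measure ((lborel :: 'a measure) \<Otimes>\<^sub>M (lborel :: 'a measure))"
      by (rule lborel_pair.sigma_finite_measure_axioms)
    show "sigma_finite_measure (lborel :: 'a measure)"
      by (rule lborel.sigma_finite_measure_axioms)
    show "(\<lambda>zw. f (fst zw) (snd zw)) \<in> borel_measurable ((lborel \<Otimes>\<^sub>M lborel) \<Otimes>\<^sub>M lborel)"
      unfolding f_def by measurable
    show "has_bochner_integral lborel (f z) (exp (- t * (norm (fst z - snd z))\<^sup>2) * C)" for z
      unfolding f_eq C_def using t
      by (intro has_bochner_integral_mult_right lborel_has_bochner_integral_translate integrable_gaussian) simp
    show "integrable (lborel \<Otimes>\<^sub>M lborel)
        (\<lambda>z. (exp (- t * (norm (fst z - snd z))\<^sup>2) * C) * (h (fst z) * h (snd z)))"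
      using integrable_mult_right[OF int, of C] by (simp add: mult_ac)
    show "0 \<le> (LINT z|(lborel \<Otimes>\<^sub>M lborel). f z w * (h (fst z) * h (snd z)))" for w
    \<comment> \<open>For fixed \<open>w\<close> the kernel is a product of a function of
      \<open>x\<close> and the same function of \<open>y\<close>, so the double integral is a
      square.\<close>
    proof -
      let ?g = "\<lambda>x. exp (- (2 * t) * (norm (x - w))\<^sup>2) * h x"
      have g: "integrable lborel ?g"
      proof (rule Bochner_Integration.integrable_bound[OF h])
        show "AE x in lborel. norm (?g x) \<le> norm (h x)"
          using t by (auto simp: abs_mult intro!: AE_I2 mult_left_le_one_le)
      qed measurable
      have "(LINT z|(lborel \<Otimes>\<^sub>M lborel). f z w * (h (fst z) * h (snd z)))
          = (LINT z|(lborel \<Otimes>\<^sub>M lborel). ?g (fst z) * ?g (snd z))"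
        by (simp add: f_def mult_ac)
      also have "\<dots> = (LINT x|lborel. ?g x) * (LINT x|lborel. ?g x)"
        by (rule integral_lborel_tensor[OF g g])
      finally show ?thesis by simp
    qed
  qed (auto simp: f_def)
  also have "\<dots> = C * (LINT z|(lborel \<Otimes>\<^sub>M lborel). exp (- t * (norm (fst z - snd z))\<^sup>2) * (h (fst z) * h (snd z)))"
    by (simp add: mult_ac flip: integral_mult_right_zero)
  finally show ?thesis
    using C by (simp add: zero_le_mult_iff)
qed

section \<open>Powers of the distance as mixtures over the scale\<close>

text \<open>The quadratic bound controls the kernel below near \<open>t = 0\<close>, the linear one
  near infinity. The quadratic one follows from \<open>exp s \<ge> 1 + s\<close> and
  \<open>(1 + s) * (1 - s + s^2) = 1 + s^3 \<ge> 1\<close>.\<close>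

lemma exp_remainder_bounds:
  assumes "0 \<le> (s::real)"
  shows "0 \<le> exp (- s) - 1 + s" and "exp (- s) - 1 + s \<le> s" and "exp (- s) - 1 + s \<le> s\<^sup>2"
proof -
  show "0 \<le> exp (- s) - 1 + s" "exp (- s) - 1 + s \<le> s"
    using exp_ge_add_one_self[of "-s"] assms by auto
  have "exp (- s) \<le> 1 / (1 + s)"
    using exp_ge_add_one_self[of s] assms by (simp add: exp_minus field_simps)
  also have "\<dots> \<le> 1 - s + s\<^sup>2"
    using assms by (simp add: divide_simps) (simp add: algebra_simps power2_eq_square)
  finally show "exp (- s) - 1 + s \<le> s\<^sup>2" by simp
qed

text \<open>The restriction to positive \<open>t\<close> is built in, so that integrals run over all
  of \<open>lborel\<close> and both nonnegativity and the slice condition hold for every real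
  \<open>t\<close>.\<close>

definition powr_kernel :: "real \<Rightarrow> real \<Rightarrow> real \<Rightarrow> real" where
  "powr_kernel q r t =
     indicator {0<..} t * ((exp (- t * r\<^sup>2) - 1 + t * r\<^sup>2) * t powr (- (q / 2) - 1))"

lemma powr_kernel_nonneg: "0 \<le> powr_kernel q r t"
  unfolding powr_kernel_def using exp_remainder_bounds(1)[of "t * r\<^sup>2"]
  by (auto simp: indicator_def)

lemma powr_kernel_measurable [measurable]:
  assumes [measurable]: "f \<in> borel_measurable M" "g \<in> borel_measurable M"
  shows "(\<lambda>x. powr_kernel q (f x) (g x)) \<in> borel_measurable M"
  unfolding powr_kernel_def by measurable

text \<open>Near 0 the quadratic bound leaves \<open>t powr (1 - q / 2)\<close>, integrable because
  \<open>q < 4\<close>; near infinity the linear bound leaves \<open>t powr (- (q / 2))\<close>,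
  integrable because \<open>q > 2\<close>.\<close>

lemma integrable_powr_kernel:
  assumes q: "2 < q" "q < 4"
  shows "integrable lborel (powr_kernel q 1)"
proof (rule Bochner_Integration.integrable_bound)
  let ?d = "\<lambda>t::real. indicator {0<..1} t * t powr (1 - q / 2) + indicator {1..} t * t powr (- (q / 2))"
  have 1: "set_integrable lebesgue {0<..1} (\<lambda>t. t powr (1 - q / 2))"
    using q by (intro nonnegative_absolutely_integrable_1 integrable_on_powr_from_0') auto
  have 2: "set_integrable lebesgue {1..} (\<lambda>t. t powr (- (q / 2)))"
    using q has_integral_powr_to_inf[of "- (q / 2)" 1]
    by (intro nonnegative_absolutely_integrable_1) auto
  have "integrable lebesgue ?d"
    using 1 2 by (intro Bochner_Integration.integrable_add) (auto simp: set_integrable_def)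
  then show "integrable lborel ?d"
    by (subst (asm) integrable_completion) measurable
  have "powr_kernel q 1 t \<le> ?d t" for t
  proof -
    consider "t \<le> 0" | "0 < t" "t < 1" | "1 \<le> t" by linarith
    then show ?thesis
    proof cases
      case 2
      have "(exp (- t) - 1 + t) * t powr (- (q / 2) - 1) \<le> t\<^sup>2 * t powr (- (q / 2) - 1)"
        using 2 exp_remainder_bounds(3)[of t] by (intro mult_right_mono) auto
      also have "\<dots> = t powr (1 - q / 2)"
        using 2 by (simp flip: powr_numeral powr_add)
      finally show ?thesis using 2 by (simp add: powr_kernel_def)
    next
      case 3
      have "(exp (- t) - 1 + t) * t powr (- (q / 2) - 1) \<le> t * t powr (- (q / 2) - 1)"
        using 3 exp_remainder_bounds(2)[of t] by (intro mult_right_mono) auto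
      also have "\<dots> = t powr (- (q / 2))"
        using 3 powr_add[of t 1 "- (q / 2) - 1"] by simp
      finally have "powr_kernel q 1 t \<le> t powr (- (q / 2))"
        using 3 by (simp add: powr_kernel_def)
      \<comment> \<open>Both indicators equal 1 at \<open>t = 1\<close>, so the first summand is
        discarded by its sign and not by being zero.\<close>
      then show ?thesis
        using 3 by (simp add: add_increasing)
    qed (simp add: powr_kernel_def)
  qed
  moreover have "0 \<le> ?d t" for t by simp
  ultimately show "AE t in lborel. norm (powr_kernel q 1 t) \<le> norm (?d t)"
    using powr_kernel_nonneg[of q 1] by (intro AE_I2) (simp only: real_norm_def abs_of_nonneg)
qed measurable

text \<open>The inequality \<open>1 - t < exp (- t)\<close> is strict for \<open>t > 0\<close>, so
  the nonnegative kernel is nonzero on a set of positive measure.\<close>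

lemma integral_powr_kernel_pos:
  assumes q: "2 < q" "q < 4"
  shows "0 < (LINT t|lborel. powr_kernel q 1 t)"
proof -
  have "powr_kernel q 1 t \<noteq> 0" if "0 < t" for t
    using exp_minus_greater[of t] that by (auto simp: powr_kernel_def)
  moreover have "\<not> (AE t in lborel. \<not> 0 < (t::real))"
  proof
    assume "AE t in lborel. \<not> 0 < (t::real)"
    then have "AE t in lborel. t \<notin> {0<..<(1::real)}"
      by eventually_elim auto
    then have "{0<..<1::real} \<in> null_sets lborel"
      by (subst AE_iff_null_sets) auto
    then show False
      by auto
  qed
  ultimately have "\<not> (AE t in lborel. powr_kernel q 1 t = 0)"
    by (metis (mono_tags, lifting) eventually_mono)
  then have "(LINT t|lborel. powr_kernel q 1 t) \<noteq> 0"
    using integrable_powr_kernel[OF q] by (subst integral_nonneg_eq_0_iff_AE) (auto simp: powr_kernel_nonneg)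
  moreover have "0 \<le> (LINT t|lborel. powr_kernel q 1 t)"
    by (simp add: powr_kernel_nonneg)
  ultimately show ?thesis by linarith
qed

text \<open>By homogeneity \<open>powr_kernel q r t\<close> is \<open>r powr (q + 2)\<close> times
  \<open>powr_kernel q 1 (r\<^sup>2 * t)\<close>; the change of variables divides by
  \<open>r\<^sup>2\<close>, which leaves \<open>r powr q\<close>.\<close>

lemma has_bochner_integral_powr_kernel:
  assumes q: "2 < q" "q < 4" and r: "0 \<le> r"
  shows "has_bochner_integral lborel (powr_kernel q r) (r powr q * (LINT t|lborel. powr_kernel q 1 t))"
\<comment> \<open>Scaling by \<open>r\<^sup>2\<close> is not invertible at \<open>r = 0\<close>;
  there the kernel is zero and so is \<open>0 powr q\<close>.\<close>
proof (cases "r = 0")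
  case True
  then show ?thesis
    by (simp add: powr_kernel_def[abs_def] has_bochner_integral_zero)
next
  case False
  with r have r: "0 < r" by simp
  let ?C = "LINT t|lborel. powr_kernel q 1 t"
  have "has_bochner_integral lborel (powr_kernel q 1) ?C"
    using integrable_powr_kernel[OF q] by (simp add: has_bochner_integral_iff)
  then have "has_bochner_integral lborel (\<lambda>t. powr_kernel q 1 (0 + r\<^sup>2 * t)) (?C /\<^sub>R \<bar>r\<^sup>2\<bar>)"
    using r by (subst (asm) lborel_has_bochner_integral_real_affine_iff[of "r\<^sup>2" _ _ 0]) auto
  then have "has_bochner_integral lborel (\<lambda>t. r powr (q + 2) * powr_kernel q 1 (0 + r\<^sup>2 * t))
      (r powr (q + 2) * (?C /\<^sub>R \<bar>r\<^sup>2\<bar>))"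
    by (rule has_bochner_integral_mult_right)
  moreover have "r powr (q + 2) * powr_kernel q 1 (0 + r\<^sup>2 * t) = powr_kernel q r t" for t
  proof (cases "0 < t")
    case True
    have "(r\<^sup>2 * t) powr (- (q / 2) - 1) = r powr (2 * (- (q / 2) - 1)) * t powr (- (q / 2) - 1)"
      using r True by (simp add: powr_mult powr_powr flip: powr_numeral)
    moreover have "r powr (q + 2) * r powr (2 * (- (q / 2) - 1)) = 1"
      using r by (simp flip: powr_add)
    ultimately show ?thesis
      using True r by (simp add: powr_kernel_def mult_ac)
  qed (use r in \<open>auto simp: powr_kernel_def indicator_def zero_less_mult_iff\<close>)
  moreover have "r powr (q + 2) * (?C /\<^sub>R \<bar>r\<^sup>2\<bar>) = r powr q * ?C"
    using r by (simp add: powr_add field_simps)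
  ultimately show ?thesis by (simp only:)
qed

section \<open>The energy of a function with vanishing moments\<close>

lemma powr_le_one_plus:
  fixes r :: real
  assumes "0 \<le> r" "0 \<le> p" "p \<le> q"
  shows "r powr p \<le> 1 + r powr q"
proof (cases "r \<le> 1")
  case True
  then have "r powr p \<le> 1"
    using assms powr_mono2[of p r 1] by simp
  then show ?thesis
    by (simp add: add_increasing2)
next
  case False
  then show ?thesis
    using assms powr_mono[of p q r] by linarith
qed

text \<open>The right-hand side is a product of a function of \<open>x\<close> and one of
  \<open>y\<close>, so the energy integrand is dominated by a tensor product. The bound comes from
  \<open>norm (x - y) \<le> 2 * max (norm x) (norm y)\<close>.\<close>

lemma norm_diff_powr_le:
  fixes x y :: "'a::real_normed_vector"
  assumes "0 \<le> q"
  shows "norm (x - y) powr q \<le> 2 powr q * ((norm x powr q + 1) * (norm y powr q + 1))"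
proof -
  have "norm (x - y) \<le> 2 * max (norm x) (norm y)"
    using norm_triangle_ineq4[of x y] by linarith
  then have "norm (x - y) powr q \<le> 2 powr q * max (norm x) (norm y) powr q"
    using assms by (subst powr_mult[symmetric]) (auto intro: powr_mono2)
  also have "max (norm x) (norm y) powr q \<le> (norm x powr q + 1) * (norm y powr q + 1)"
    by (auto simp: max_def algebra_simps add_increasing add_increasing2)
  finally show ?thesis by simp
qed

text \<open>Everything is stated for a Borel function and \<open>lborel\<close>, where Fubini is
  available on \<open>lborel \<Otimes>\<^sub>M lborel\<close>; a Borel representative is supplied in
  the final theorem.\<close>

locale zero_moment_function =
  fixes h :: "'a::euclidean_space \<Rightarrow> real" and q :: real
  assumes measurable_h [measurable]: "h \<in> borel_measurable borel"
    and integrable_weight: "integrable lborel (\<lambda>x. (norm x powr q + 1) * \<bar>h x\<bar>)"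
    and two_le: "2 \<le> q"
    and zeroth_moment: "(LINT x|lborel. h x) = 0"
    and first_moment: "\<And>b. b \<in> Basis \<Longrightarrow> (LINT x|lborel. (x \<bullet> b) * h x) = 0"
begin

lemma integrable_dominated:
  assumes [measurable]: "f \<in> borel_measurable borel" and "\<And>x. \<bar>f x\<bar> \<le> norm x powr q + 1"
  shows "integrable lborel (\<lambda>x. f x * h x)"
proof (rule Bochner_Integration.integrable_bound[OF integrable_weight])
  show "AE x in lborel. norm (f x * h x) \<le> norm ((norm x powr q + 1) * \<bar>h x\<bar>)"
    using assms(2) by (auto simp: abs_mult intro!: AE_I2 mult_right_mono)
qed measurable

lemma integrable_h: "integrable lborel h"
  using integrable_dominated[of "\<lambda>_. 1"] by simp

text \<open>The exponent \<open>p\<close> is kept apart from the weight exponent \<open>q\<close>: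
  for one fixed \<open>h\<close>, the exponent 2 and a sequence tending to 4 are needed as
  well.\<close>

definition energy :: "real \<Rightarrow> real" where
  "energy p = (LINT z|(lborel \<Otimes>\<^sub>M lborel). norm (fst z - snd z) powr p * (h (fst z) * h (snd z)))"

lemma integrable_energy:
  assumes p: "0 \<le> p" "p \<le> q"
  shows "integrable (lborel \<Otimes>\<^sub>M lborel) (\<lambda>z. norm (fst z - snd z) powr p * (h (fst z) * h (snd z)))"
proof (rule Bochner_Integration.integrable_bound)
  let ?W = "\<lambda>x. (norm x powr p + 1) * \<bar>h x\<bar>"
  have "\<bar>norm x powr p\<bar> \<le> norm x powr q + 1" for x :: 'a
    using powr_le_one_plus[OF norm_ge_zero p, of x] by simp
  then have "integrable lborel (\<lambda>x. norm x powr p * h x)"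
    by (intro integrable_dominated) measurable
  then have "integrable lborel (\<lambda>x. \<bar>norm x powr p * h x\<bar> + \<bar>h x\<bar>)"
    by (intro Bochner_Integration.integrable_add integrable_abs integrable_h)
  then have W: "integrable lborel ?W"
    by (simp add: abs_mult algebra_simps)
  show "integrable (lborel \<Otimes>\<^sub>M lborel) (\<lambda>z. 2 powr p * (?W (fst z) * ?W (snd z)))"
    by (intro integrable_mult_right integrable_lborel_tensor W)
  have "norm (fst z - snd z) powr p * (\<bar>h (fst z)\<bar> * \<bar>h (snd z)\<bar>)
      \<le> (2 powr p * ((norm (fst z) powr p + 1) * (norm (snd z) powr p + 1))) * (\<bar>h (fst z)\<bar> * \<bar>h (snd z)\<bar>)" for z
    using p by (intro mult_right_mono norm_diff_powr_le) auto
  then show "AE z in lborel \<Otimes>\<^sub>M lborel. norm (norm (fst z - snd z) powr p * (h (fst z) * h (snd z)))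
      \<le> norm (2 powr p * (?W (fst z) * ?W (snd z)))"
    by (intro AE_I2) (simp add: abs_mult mult_ac)
qed measurable

text \<open>Expanding the squared distance gives tensor products only. The two square terms carry
  the factor \<open>LINT x|lborel. h x\<close>, and the cross terms are products of first moments,
  so all vanish.\<close>

lemma energy_two: "energy 2 = 0"
proof -
  let ?P = "lborel \<Otimes>\<^sub>M lborel :: ('a \<times> 'a) measure"
  have "\<bar>(norm x)\<^sup>2\<bar> \<le> norm x powr q + 1" for x :: 'a
    using powr_le_one_plus[of "norm x" 2 q] two_le by (simp add: powr_numeral)
  then have sq: "integrable lborel (\<lambda>x. (norm x)\<^sup>2 * h x)"
    by (intro integrable_dominated) measurable
  have "\<bar>x \<bullet> b\<bar> \<le> norm x powr q + 1" if "b \<in> Basis" for x b :: 'a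
    using powr_le_one_plus[of "norm x" 1 q] two_le Basis_le_norm[OF that, of x] by simp
  then have lin: "integrable lborel (\<lambda>x. (x \<bullet> b) * h x)" if "b \<in> Basis" for b
    using that by (intro integrable_dominated) measurable
  note ints = integrable_lborel_tensor[OF sq integrable_h] integrable_lborel_tensor[OF integrable_h sq]
    integrable_lborel_tensor[OF lin lin]
  have "norm (x - y) powr 2 * (h x * h y) = ((norm x)\<^sup>2 * h x) * h y + h x * ((norm y)\<^sup>2 * h y)
      - 2 * (\<Sum>b\<in>Basis. ((x \<bullet> b) * h x) * ((y \<bullet> b) * h y))" for x y
  proof -
    have "norm (x - y) powr 2 = (norm x)\<^sup>2 + (norm y)\<^sup>2 - 2 * (\<Sum>b\<in>Basis. (x \<bullet> b) * (y \<bullet> b))"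
      by (simp add: powr_numeral power2_norm_eq_inner inner_diff_left inner_diff_right inner_commute
          euclidean_inner[of x y])
    then show ?thesis
      by (simp only:) (simp add: algebra_simps sum_distrib_left)
  qed
  then have "energy 2 = (LINT z|?P. ((norm (fst z))\<^sup>2 * h (fst z)) * h (snd z)
      + h (fst z) * ((norm (snd z))\<^sup>2 * h (snd z))
      - 2 * (\<Sum>b\<in>Basis. ((fst z \<bullet> b) * h (fst z)) * ((snd z \<bullet> b) * h (snd z))))"
    by (simp add: energy_def)
  also have "\<dots> = (LINT z|?P. ((norm (fst z))\<^sup>2 * h (fst z)) * h (snd z))
      + (LINT z|?P. h (fst z) * ((norm (snd z))\<^sup>2 * h (snd z)))
      - 2 * (\<Sum>b\<in>Basis. (LINT z|?P. ((fst z \<bullet> b) * h (fst z)) * ((snd z \<bullet> b) * h (snd z))))"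
    using ints by simp
  also have "\<dots> = 0"
    unfolding integral_lborel_tensor[OF sq integrable_h] integral_lborel_tensor[OF integrable_h sq]
    by (simp add: integral_lborel_tensor[OF lin lin] zeroth_moment first_moment)
  finally show ?thesis .
qed

lemma energy_nonneg_interior:
  assumes p: "2 < p" "p < 4" "p \<le> q"
  shows "0 \<le> energy p"
proof -
  let ?P = "lborel \<Otimes>\<^sub>M lborel :: ('a \<times> 'a) measure"
  define u where "u = (\<lambda>z. h (fst z) * h (snd z))"
  have u_meas [measurable]: "u \<in> borel_measurable ?P"
    unfolding u_def by measurable
  have u: "integrable ?P u" and u_zero: "(LINT z|?P. u z) = 0"
    unfolding u_def using integrable_lborel_tensor[OF integrable_h integrable_h]
    by (auto simp: integral_lborel_tensor[OF integrable_h integrable_h] zeroth_moment)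
  have sq: "integrable ?P (\<lambda>z. (norm (fst z - snd z))\<^sup>2 * u z)"
    and sq_zero: "(LINT z|?P. (norm (fst z - snd z))\<^sup>2 * u z) = 0"
    using integrable_energy[of 2] energy_two two_le by (auto simp: powr_numeral energy_def u_def)
  define C where "C = (LINT t|lborel. powr_kernel p 1 t)"
  have C: "0 < C"
    unfolding C_def using p by (intro integral_powr_kernel_pos)
  have "0 \<le> (LINT z|?P. (norm (fst z - snd z) powr p * C) * u z)"
  proof (rule integral_mixture_nonneg[where f = "\<lambda>z. powr_kernel p (norm (fst z - snd z))" and N = lborel])
    show "sigma_finite_measure ?P"
      by (rule lborel_pair.sigma_finite_measure_axioms)
    show "sigma_finite_measure (lborel :: real measure)"
      by (rule lborel.sigma_finite_measure_axioms)
    show "has_bochner_integral lborel (powr_kernel p (norm (fst z - snd z))) (norm (fst z - snd z) powr p * C)"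
      for z :: "'a \<times> 'a"
      unfolding C_def using p by (intro has_bochner_integral_powr_kernel) auto
    show "integrable ?P (\<lambda>z. (norm (fst z - snd z) powr p * C) * u z)"
      using integrable_mult_right[OF integrable_energy[of p], of C] p by (simp add: u_def mult_ac)
    show "0 \<le> (LINT z|?P. powr_kernel p (norm (fst z - snd z)) t * u z)" for t
    proof (cases "0 < t")
      case True
      let ?g = "\<lambda>z. exp (- t * (norm (fst z - snd z))\<^sup>2) * u z"
      let ?c = "t powr (- (p / 2) - 1)"
      have g: "integrable ?P ?g"
      proof (rule Bochner_Integration.integrable_bound[OF u])
        show "AE z in ?P. norm (?g z) \<le> norm (u z)"
          using True by (auto simp: abs_mult intro!: AE_I2 mult_left_le_one_le)
      qed measurable
      \<comment> \<open>The three terms of the kernel are separately integrable against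
        \<open>u\<close>. The constant and the quadratic one integrate to zero, leaving a positive
        multiple of the Gaussian form.\<close>
      have "(LINT z|?P. powr_kernel p (norm (fst z - snd z)) t * u z)
          = (LINT z|?P. ?c * (?g z - u z + t * ((norm (fst z - snd z))\<^sup>2 * u z)))"
        using True by (simp add: powr_kernel_def algebra_simps)
      also have "\<dots> = ?c * ((LINT z|?P. ?g z) - (LINT z|?P. u z)
          + t * (LINT z|?P. (norm (fst z - snd z))\<^sup>2 * u z))"
        using g u sq by simp
      also have "\<dots> = ?c * (LINT z|?P. ?g z)"
        by (simp add: u_zero sq_zero)
      also have "\<dots> \<ge> 0"
        unfolding u_def by (intro mult_nonneg_nonneg gaussian_kernel_nonneg integrable_h True powr_ge_zero)
      finally show ?thesis .
    qed (simp add: powr_kernel_def)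
  qed (auto simp: powr_kernel_nonneg)
  also have "\<dots> = C * energy p"
    unfolding energy_def u_def by (simp add: mult_ac flip: integral_mult_right_zero)
  finally show ?thesis
    using C by (simp add: zero_le_mult_iff)
qed

lemma energy_nonneg:
  assumes "q \<le> 4"
  shows "0 \<le> energy q"
proof (cases "q = 2 \<or> q < 4")
  case True
  then show ?thesis
    using two_le energy_two energy_nonneg_interior[of q] by fastforce
next
  case False
  with assms have q: "q = 4" by simp
  let ?P = "lborel \<Otimes>\<^sub>M lborel :: ('a \<times> 'a) measure"
  \<comment> \<open>At exponent 4 the scale integral diverges at \<open>t = 0\<close>, hence the
    approximation from below. The sequence starts at 3, so every term lies strictly between 2 and
    4.\<close>
  let ?p = "\<lambda>n. 4 - inverse (real (Suc n))"
  have p: "2 < ?p n" "?p n < 4" for n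
    using inverse_le_1_iff[of "real (Suc n)"] by (auto simp del: of_nat_Suc intro: less_le_trans)
  have p_lim: "?p \<longlonglongrightarrow> 4"
    using tendsto_diff[OF tendsto_const LIMSEQ_inverse_real_of_nat, of 4] by simp
  have "(\<lambda>n. energy (?p n)) \<longlonglongrightarrow> energy 4"
    unfolding energy_def
  proof (rule integral_dominated_convergence)
    \<comment> \<open>This majorant is independent of \<open>n\<close>, since
      \<open>r powr p \<le> 1 + r powr 4\<close> for every exponent \<open>p\<close> of the
      sequence.\<close>
    let ?w = "\<lambda>z. \<bar>h (fst z) * h (snd z)\<bar> + \<bar>norm (fst z - snd z) powr 4 * (h (fst z) * h (snd z))\<bar>"
    show "integrable ?P ?w"
      using integrable_energy[of 4] q
      by (intro Bochner_Integration.integrable_add integrable_abs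
          integrable_lborel_tensor integrable_h) auto
    show "AE z in ?P. (\<lambda>n. norm (fst z - snd z) powr ?p n * (h (fst z) * h (snd z)))
        \<longlonglongrightarrow> norm (fst z - snd z) powr 4 * (h (fst z) * h (snd z))"
    proof (intro AE_I2)
      fix z :: "'a \<times> 'a"
      show "(\<lambda>n. norm (fst z - snd z) powr ?p n * (h (fst z) * h (snd z)))
        \<longlonglongrightarrow> norm (fst z - snd z) powr 4 * (h (fst z) * h (snd z))"
        \<comment> \<open>Continuity of \<open>powr\<close> in the exponent is used at a nonzero
          base; on the diagonal the base is 0 and all terms are 0.\<close>
        by (cases "fst z = snd z") (auto simp del: of_nat_Suc powr_numeral intro!: tendsto_mult tendsto_powr p_lim)
    qed
    fix n
    have "norm (fst z - snd z) powr ?p n * \<bar>h (fst z) * h (snd z)\<bar>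
        \<le> (1 + norm (fst z - snd z) powr 4) * \<bar>h (fst z) * h (snd z)\<bar>" for z
      using p[of n] by (intro mult_right_mono powr_le_one_plus) auto
    then show "AE z in ?P. norm (norm (fst z - snd z) powr ?p n * (h (fst z) * h (snd z))) \<le> ?w z"
      by (intro AE_I2) (simp add: abs_mult algebra_simps)
  qed measurable
  then show ?thesis
    unfolding q
  proof (rule LIMSEQ_le_const)
    show "\<exists>N. \<forall>n\<ge>N. 0 \<le> energy (?p n)"
      using p q by (intro exI[of _ 0] allI impI energy_nonneg_interior) (auto simp only: intro: less_imp_le)
  qed
qed

end

section \<open>Passage from Lebesgue to Borel measure\<close>

text \<open>A preimage under \<open>f\<close> agrees with the one under \<open>g\<close> up to a
  subset of a null set, and the completion contains all such subsets.\<close>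

lemma measurable_completion_AE:
  assumes g: "g \<in> M \<rightarrow>\<^sub>M N" and ae: "AE x in M. f x = g x" and "\<And>x. f x \<in> space N"
  shows "f \<in> completion M \<rightarrow>\<^sub>M N"
proof (rule measurableI)
  note [measurable] = measurable_completion[OF g]
  fix A assume [measurable]: "A \<in> sets N"
  have [measurable]: "Measurable.pred (completion M) (\<lambda>x. f x \<noteq> g x)"
      "Measurable.pred (completion M) (\<lambda>x. f x \<in> A \<and> f x \<noteq> g x)"
    using ae by (auto intro!: sets_completion_AE)
  have "f -` A \<inter> space (completion M) =
      {x \<in> space (completion M). g x \<in> A \<and> \<not> f x \<noteq> g x \<or> (f x \<in> A \<and> f x \<noteq> g x)}"
    by auto
  also have "\<dots> \<in> sets (completion M)"
    by measurable
  finally show "f -` A \<inter> space (completion M) \<in> sets (completion M)" .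
qed (use assms in auto)

lemma integral_completion_cong_AE:
  fixes f g :: "'a \<Rightarrow> real"
  assumes g: "g \<in> borel_measurable M" and ae: "AE x in M. f x = g x"
  shows "integrable (completion M) f \<longleftrightarrow> integrable M g"
    and "integral\<^sup>L (completion M) f = integral\<^sup>L M g"
proof -
  have f: "f \<in> borel_measurable (completion M)"
    using g ae by (rule measurable_completion_AE) simp
  have g': "g \<in> borel_measurable (completion M)"
    using g by (rule measurable_completion)
  show "integrable (completion M) f \<longleftrightarrow> integrable M g"
    using integrable_cong_AE[OF f g' AE_completion[OF ae]] integrable_completion[OF g] by simp
  show "integral\<^sup>L (completion M) f = integral\<^sup>L M g"
    using integral_cong_AE[OF f g' AE_completion[OF ae]] integral_completion[OF g] by simp
qed

theorem theorem2p4: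
  fixes q :: real and h :: "real ^ 'n \<Rightarrow> real"
  assumes "2 \<le> q" and "q \<le> 4"
    and "h \<in> X0_space q"
  shows "F q h \<ge> 0"
proof -
  have h: "integrable lebesgue h" "integrable lebesgue (\<lambda>x. (norm x powr q + 1) * \<bar>h x\<bar>)"
      "(LINT x|lebesgue. h x) = 0" "\<And>i. (LINT x|lebesgue. x $ i * h x) = 0"
    using assms(3) by (auto simp: X0_space_def X_space_def)
  obtain g where [measurable]: "g \<in> borel_measurable borel" and ae: "AE x in lborel. h x = g x"
    using completion_ex_borel_measurable_real[of h lborel] h(1) by auto
  interpret zero_moment_function g q
  proof
    show "integrable lborel (\<lambda>x. (norm x powr q + 1) * \<bar>g x\<bar>)"
      using h(2) ae by (subst integral_completion_cong_AE(1)[symmetric]) auto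
    show "(LINT x|lborel. g x) = 0"
      using h(3) ae by (subst integral_completion_cong_AE(2)[symmetric]) auto
    fix b :: "real ^ 'n" assume "b \<in> Basis"
    then obtain i where "b = axis i 1"
      by (auto simp: Basis_vec_def)
    then have "(LINT x|lebesgue. (x \<bullet> b) * h x) = 0"
      using h(4)[of i] by (simp add: cart_eq_inner_axis)
    then show "(LINT x|lborel. (x \<bullet> b) * g x) = 0"
      using ae by (subst integral_completion_cong_AE(2)[symmetric, where f = "\<lambda>x. (x \<bullet> b) * h x"]) auto
  qed (use assms in auto)
  \<comment> \<open>\<open>lebesgue\<close> on pairs is the completion of \<open>lborel\<close> on
    pairs, and \<open>lborel_prod\<close> identifies the latter with the product measure in
    \<open>energy\<close>.\<close>
  have "F q h = energy q"
    unfolding F_def energy_def lborel_prod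
  proof (rule integral_completion_cong_AE(2))
    show "(\<lambda>z. norm (fst z - snd z) powr q * (g (fst z) * g (snd z)))
        \<in> borel_measurable (lborel :: ((real ^ 'n) \<times> (real ^ 'n)) measure)"
      unfolding lborel_prod[symmetric] by measurable
    \<comment> \<open>Taking the exceptional set to be a Borel null set makes the condition on both
      coordinates measurable in the product, so it holds almost everywhere by sections.\<close>
    obtain N where N: "N \<in> null_sets lborel" "\<And>x. x \<notin> N \<Longrightarrow> h x = g x"
      using ae by (auto elim!: AE_E3)
    then have [measurable]: "N \<in> sets borel" and "AE x in lborel. x \<notin> N"
      by (auto intro: AE_not_in)
    have "AE z in lborel \<Otimes>\<^sub>M lborel. fst z \<notin> N \<and> snd z \<notin> N"
    proof (rule lborel_pair.AE_pair_measure)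
      show "AE x in lborel. AE y in lborel. fst (x, y) \<notin> N \<and> snd (x, y) \<notin> N"
        using \<open>AE x in lborel. x \<notin> N\<close> by auto
    qed measurable
    then show "AE z in lborel. (case z of (x, y) \<Rightarrow> norm (x - y) powr q * h x * h y)
        = norm (fst z - snd z) powr q * (g (fst z) * g (snd z))"
      unfolding lborel_prod by eventually_elim (auto simp: N)
  qed
  then show ?thesis
    using energy_nonneg assms(2) by simp
qed

end
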